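(* Let $f^1,\dots,f^p:\mathbb{R}^n\to\mathbb{R}^m$ be twice continuously differentiable and $F(x)=\{f^1(x),\dots,f^p(x)\}$. Let $\bar x\in\mathbb{R}^n$ and let $(\bar a,\bar u)\in P_{\bar x}\times\mathbb{R}^n$ be such that $\Phi(\bar x)=\xi_{\bar x}(\bar a,\bar u)$. Then the following are equivalent: (i) $\bar x$ is a nonstationary point (i.e. not a stationary point) of the problem of minimizing $F$ with respect to the lower set less relation; (ii) $\Phi(\bar x)<0$; (iii) $\bar u\neq0$.
   Context: $K\subset\mathbb{R}^m$ is a closed, convex, pointed cone with nonempty interior, and $e\in\mathrm{int}(K)$ is fixed. The Gerstewitz function is $\mathcal{G}_e(y)=\min\{t\in\mathbb{R}: te\in y+K\}$. For $A\subseteq\mathbb{R}^m$, $\mathrm{Min}(A,K)=\{z\in A:(z-K)\cap A=\{z\}\}$. Put $I(x)=\{i: f^i(x)\in\mathrm{Min}(F(x),K)\}$, $I_r(x)=\{i\in I(x): f^i(x)=r\}$, $w(x)=|\mathrm{Min}(F(x),K)|$. Enumerating $\mathrm{Min}(F(x),K)=\{r_1^x,\dots,r_{w(x)}^x\}$, the partition set at $x$ is $P_x=\prod_{j=1}^{w(x)} I_{r_j^x}(x)$, with elements $a=(a_1,\dots,a_{w(x)})$. $\nabla f^i(x)\in\mathbb{R}^{n\times m}$ denotes the transposed Jacobian, so $\nabla f^i(x)^\top u\in\mathbb{R}^m$. A point $\bar x$ is stationary if for every $a\in P_{\bar x}$ and every $u\in\mathbb{R}^n$ there is $j\in\{1,\dots,w(\bar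 x)\}$ with $\nabla f^{a_j}(\bar x)^\top u\notin-\mathrm{int}(K)$ (equivalently $\mathcal{G}_e(\nabla f^{a_j}(\bar x)^\top u)\ge0$). For each $i$ and $x$, $B^i(x)=(B^{i,1}(x),\dots,B^{i,m}(x))$ is an $m$-tuple of symmetric real $n\times n$ matrices (Hessian approximation), $u^\top B^i(x)u:=(u^\top B^{i,l}(x)u)_{l=1}^m\in\mathbb{R}^m$, and $B^i(x)$ is positive definite in the sense that $u^\top B^i(x)u\in\mathrm{int}(K)$ for all $u\neq0$. $\xi_x(a,u)=\max_{1\le j\le w(x)}\mathcal{G}_e\big(\nabla f^{a_j}(x)^\top u+\tfrac12u^\top B^{a_j}(x)u\big)$ for $a\in P_x,\ u\in\mathbb{R}^n$, and $\Phi(x)=\min_{(a,u)\in P_x\times\mathbb{R}^n}\xi_x(a,u)$. *)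

theory Defs
  imports "HOL-Analysis.Analysis"
begin

definition pointed :: "'a::real_vector set \<Rightarrow> bool" where
  "pointed K \<longleftrightarrow> K \<inter> uminus ` K = {0}"

(* f is C^2: f' and f'' are the first and second derivatives as bounded linear maps. *)
definition twice_continuously_differentiable ::
    "('a::real_normed_vector \<Rightarrow> 'b::real_normed_vector) \<Rightarrow> bool" where
  "twice_continuously_differentiable f \<longleftrightarrow>
     (\<exists>(f' :: 'a \<Rightarrow> 'a \<Rightarrow>\<^sub>L 'b) (f'' :: 'a \<Rightarrow> 'a \<Rightarrow>\<^sub>L ('a \<Rightarrow>\<^sub>L 'b)).
        (\<forall>x. (f has_derivative blinfun_apply (f' x)) (at x)) \<and>
        (\<forall>x. (f' has_derivative blinfun_apply (f'' x)) (at x)) \<and>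
        continuous_on UNIV f'')"

(* The minimum over t is written LEAST; it exists when K is a closed, convex, pointed cone
   and e lies in its interior. *)
definition gerstewitz :: "'a::real_vector set \<Rightarrow> 'a \<Rightarrow> 'a \<Rightarrow> real" where
  "gerstewitz K e y = (LEAST t. t *\<^sub>R e \<in> {y + k |k. k \<in> K})"

definition Min_set :: "'a::real_vector set \<Rightarrow> 'a set \<Rightarrow> 'a set" where
  "Min_set A K = {z \<in> A. {z - k |k. k \<in> K} \<inter> A = {z}}"

(* The set-valued map F, with the p component functions indexed by 1, ..., p. *)
definition set_map :: "(nat \<Rightarrow> 'a \<Rightarrow> 'b) \<Rightarrow> nat \<Rightarrow> 'a \<Rightarrow> 'b set" where
  "set_map f p x = (\<lambda>i. f i x) ` {1..p}"

definition active_indices ::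
    "'b::real_vector set \<Rightarrow> (nat \<Rightarrow> 'a \<Rightarrow> 'b) \<Rightarrow> nat \<Rightarrow> 'a \<Rightarrow> nat set" where
  "active_indices K f p x = {i \<in> {1..p}. f i x \<in> Min_set (set_map f p x) K}"

definition active_indices_at ::
    "'b::real_vector set \<Rightarrow> (nat \<Rightarrow> 'a \<Rightarrow> 'b) \<Rightarrow> nat \<Rightarrow> 'a \<Rightarrow> 'b \<Rightarrow> nat set" where
  "active_indices_at K f p x v = {i \<in> active_indices K f p x. f i x = v}"

definition num_min ::
    "'b::real_vector set \<Rightarrow> (nat \<Rightarrow> 'a \<Rightarrow> 'b) \<Rightarrow> nat \<Rightarrow> 'a \<Rightarrow> nat" where
  "num_min K f p x = card (Min_set (set_map f p x) K)"

definition enumerates_min ::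
    "'b::real_vector set \<Rightarrow> (nat \<Rightarrow> 'a \<Rightarrow> 'b) \<Rightarrow> nat \<Rightarrow> ('a \<Rightarrow> nat \<Rightarrow> 'b) \<Rightarrow> bool" where
  "enumerates_min K f p r \<longleftrightarrow>
     (\<forall>x. bij_betw (r x) {1..num_min K f p x} (Min_set (set_map f p x) K))"

(* A tuple a is an extensional function on {1..w(x)}; r x j is the j-th minimal element
   at x in the chosen enumeration. *)
definition partition_set ::
    "'b::real_vector set \<Rightarrow> (nat \<Rightarrow> 'a \<Rightarrow> 'b) \<Rightarrow> nat \<Rightarrow> ('a \<Rightarrow> nat \<Rightarrow> 'b) \<Rightarrow> 'a \<Rightarrow> (nat \<Rightarrow> nat) set" where
  "partition_set K f p r x =
     (\<Pi>\<^sub>E j\<in>{1..num_min K f p x}. active_indices_at K f p x (r x j))"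

definition grad :: "(real^'n \<Rightarrow> real^'m) \<Rightarrow> real^'n \<Rightarrow> real^'m^'n" where
  "grad g x = transpose (jacobian g (at x))"

definition stationary_point ::
    "(real^'m) set \<Rightarrow> (nat \<Rightarrow> real^'n \<Rightarrow> real^'m) \<Rightarrow> nat \<Rightarrow> (real^'n \<Rightarrow> nat \<Rightarrow> real^'m) \<Rightarrow> real^'n \<Rightarrow> bool" where
  "stationary_point K f p r x \<longleftrightarrow>
     (\<forall>a \<in> partition_set K f p r x. \<forall>u. \<exists>j \<in> {1..num_min K f p x}.
        transpose (grad (f (a j)) x) *v u \<notin> uminus ` interior K)"

(* An m-tuple of n x n matrices is a vector of matrices. *)
definition quad_form :: "(real^'n^'n)^'m \<Rightarrow> real^'n \<Rightarrow> real^'m" where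
  "quad_form H u = (\<chi> l. u \<bullet> (H $ l *v u))"

definition symmetric_tuple :: "(real^'n^'n)^'m \<Rightarrow> bool" where
  "symmetric_tuple H \<longleftrightarrow> (\<forall>l. transpose (H $ l) = H $ l)"

definition K_positive_definite :: "(real^'m) set \<Rightarrow> (real^'n^'n)^'m \<Rightarrow> bool" where
  "K_positive_definite K H \<longleftrightarrow> (\<forall>u. u \<noteq> 0 \<longrightarrow> quad_form H u \<in> interior K)"

definition xi ::
    "(real^'m) set \<Rightarrow> real^'m \<Rightarrow> (nat \<Rightarrow> real^'n \<Rightarrow> real^'m) \<Rightarrow> nat \<Rightarrow>
     (nat \<Rightarrow> real^'n \<Rightarrow> (real^'n^'n)^'m) \<Rightarrow> real^'n \<Rightarrow> (nat \<Rightarrow> nat) \<Rightarrow> real^'n \<Rightarrow> real" where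
  "xi K e f p B x a u =
     Max ((\<lambda>j. gerstewitz K e
                 (transpose (grad (f (a j)) x) *v u + (1/2) *\<^sub>R quad_form (B (a j) x) u))
          ` {1..num_min K f p x})"

(* The minimum over P_x x R^n is written LEAST; it is attained when every B i x is
   positive definite with respect to K. *)
definition Phi ::
    "(real^'m) set \<Rightarrow> real^'m \<Rightarrow> (nat \<Rightarrow> real^'n \<Rightarrow> real^'m) \<Rightarrow> nat \<Rightarrow>
     (nat \<Rightarrow> real^'n \<Rightarrow> (real^'n^'n)^'m) \<Rightarrow> (real^'n \<Rightarrow> nat \<Rightarrow> real^'m) \<Rightarrow> real^'n \<Rightarrow> real" where
  "Phi K e f p B r x =
     (LEAST t. t \<in> (\<lambda>(a, u). xi K e f p B x a u) ` (partition_set K f p r x \<times> UNIV))"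

end

theory Submission
  imports Defs
begin

text \<open>
  Write \<open>g\<close> for the Gerstewitz function of \<open>(K, e)\<close>, and for a tuple \<open>a\<close> in the partition set
  let \<open>L\<^sub>j\<close> be the derivative and \<open>q\<^sub>j\<close> the quadratic form belonging to the index \<open>a j\<close>, so that
  \<open>\<xi>(a, u)\<close> is the maximum over \<open>j\<close> of \<open>g (L\<^sub>j u + q\<^sub>j u / 2)\<close>.  Everything rests on two
  translations of \<open>g\<close> into the cone: \<open>g y \<le> t\<close> iff \<open>t e - y \<in> K\<close> (\<open>gerstewitz_le_iff\<close>), and
  \<open>g y < 0\<close> iff \<open>-y \<in> int K\<close> (\<open>gerstewitz_neg_iff\<close>).

  The equivalence is a cycle of implications.

  \<^item> At a nonstationary point some \<open>a\<close> and \<open>u\<close> satisfy \<open>L\<^sub>j u \<in> - int K\<close> for all \<open>j\<close>.  Along \<open>t u\<close>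
    with small \<open>t > 0\<close> the linear term is of order \<open>t\<close> and the quadratic one of order \<open>t\<^sup>2\<close>, so all
    terms of \<open>\<xi>(a, t u)\<close> are negative (\<open>descent_step\<close>) and the minimum \<open>\<Phi>\<close> is negative.

  \<^item> If \<open>\<Phi> < 0\<close>, the minimizing direction is not zero, because \<open>\<xi>(a, 0) = g 0 = 0\<close>.

  \<^item> If the minimizing direction \<open>u\<close> is not zero, then \<open>\<xi>(a, u) = \<Phi> \<le> \<xi>(a, 0) = 0\<close> gives
    \<open>-(L\<^sub>j u + q\<^sub>j u / 2) \<in> K\<close>; adding \<open>q\<^sub>j u / 2 \<in> int K\<close> yields \<open>-L\<^sub>j u \<in> int K\<close> for all \<open>j\<close>
    (\<open>descent_if_model_nonpos\<close>), so the point is nonstationary.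

  All of this uses that \<open>\<Phi>\<close> is a lower bound of \<open>\<xi>\<close>, that is, that the minimum defining it
  exists.  The partition set is finite, so it suffices to minimize in \<open>u\<close> for a fixed tuple.
  There \<open>\<xi>\<close> is continuous, since \<open>g\<close> is Lipschitz (\<open>gerstewitz_lipschitz\<close>), and it is positive far
  from the origin, since by compactness of the unit sphere \<open>q\<^sub>j u\<close> dominates a positive multiple of
  \<open>\<bar>u\<bar>\<^sup>2 e\<close> (\<open>model_coercive\<close>).  The maximum over \<open>j\<close> is one over a nonempty set because a nonempty
  finite set has minimal elements.
\<close>

section \<open>The Gerstewitz function of a solid pointed cone\<close>

locale solid_cone =
  fixes K :: "'a::euclidean_space set" and e :: 'a
  assumes closed: "closed K" and convex: "convex K" and cone: "cone K"
    and pointed: "pointed K" and e_interior: "e \<in> interior K"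
begin

lemma add_mem: "x \<in> K \<Longrightarrow> y \<in> K \<Longrightarrow> x + y \<in> K"
  using convex cone convex_cone by blast

lemma scale_mem: "x \<in> K \<Longrightarrow> 0 \<le> c \<Longrightarrow> c *\<^sub>R x \<in> K"
  using cone by (simp add: cone_def)

lemma e_mem: "e \<in> K"
  using e_interior interior_subset by blast

lemma zero_mem: "0 \<in> K"
  using scale_mem[OF e_mem, of 0] by simp

lemma antisym_mem:
  assumes "x \<in> K" "- x \<in> K"
  shows "x = 0"
proof -
  have "x \<in> uminus ` K"
    using assms(2) by (metis image_eqI minus_minus)
  then show ?thesis
    using assms(1) pointed unfolding pointed_def by blast
qed

lemma interior_add:
  assumes "x \<in> K" "y \<in> interior K"
  shows "x + y \<in> interior K"
proof -
  have "(+) x ` interior K \<subseteq> interior K"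
  proof (rule interior_maximal)
    show "(+) x ` interior K \<subseteq> K"
      using assms(1) add_mem interior_subset by blast
    show "open ((+) x ` interior K)"
      by (rule open_translation[OF open_interior])
  qed
  then show ?thesis
    using assms(2) by blast
qed

lemma interior_scale:
  assumes "y \<in> interior K" "c > 0"
  shows "c *\<^sub>R y \<in> interior K"
proof -
  have "(*\<^sub>R) c ` interior K \<subseteq> interior K"
  proof (rule interior_maximal)
    show "(*\<^sub>R) c ` interior K \<subseteq> K"
      using assms(2) scale_mem interior_subset by fastforce
    show "open ((*\<^sub>R) c ` interior K)"
      using assms(2) by (intro open_scaling) auto
  qed
  then show ?thesis
    using assms(1) by blast
qed

text \<open>
  An interior point of the cone absorbs the unit ball; by scaling, a multiple of \<open>e\<close> of the order
  of the norm dominates any vector.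
\<close>
lemma absorbing:
  obtains M where "M > 0" "\<And>y. (M * norm y) *\<^sub>R e - y \<in> K"
proof -
  obtain \<rho> where \<rho>: "\<rho> > 0" "cball e \<rho> \<subseteq> K"
    using e_interior mem_interior_cball by blast
  have "(1 / \<rho> * norm y) *\<^sub>R e - y \<in> K" for y
  proof (cases "y = 0")
    case True
    then show ?thesis by (simp add: zero_mem)
  next
    case False
    have "e - (\<rho> / norm y) *\<^sub>R y \<in> cball e \<rho>"
      using False \<rho>(1) by (simp add: dist_norm)
    then have "(norm y / \<rho>) *\<^sub>R (e - (\<rho> / norm y) *\<^sub>R y) \<in> K"
      using \<rho> by (intro scale_mem) auto
    then show ?thesis
      using False \<rho>(1) by (simp add: scaleR_diff_right)
  qed
  with \<rho>(1) show ?thesis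
    by (intro that[of "1 / \<rho>"]) auto
qed

text \<open>Otherwise \<open>e = 0\<close> by pointedness, so \<open>0\<close> is interior and \<open>K\<close> contains a line.\<close>
lemma minus_e_not_mem: "- e \<notin> K"
proof
  assume "- e \<in> K"
  then have "e = 0"
    using antisym_mem e_mem by blast
  obtain M where M: "\<And>y. (M * norm y) *\<^sub>R e - y \<in> K"
    using absorbing by blast
  have all: "y \<in> K" for y
    using M[of "- y"] \<open>e = 0\<close> by simp
  obtain b :: 'a where "b \<in> Basis"
    using nonempty_Basis by blast
  then show False
    using antisym_mem[of b] all nonzero_Basis by blast
qed

lemma nonneg_if_multiple_of_e_mem:
  assumes "t *\<^sub>R e \<in> K"
  shows "0 \<le> t"
proof (rule ccontr)
  assume "\<not> 0 \<le> t"
  then have "(- 1 / t) *\<^sub>R (t *\<^sub>R e) \<in> K"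
    by (intro scale_mem[OF assms]) (simp add: divide_nonpos_neg)
  then show False
    using \<open>\<not> 0 \<le> t\<close> minus_e_not_mem by simp
qed

text \<open>
  The set of admissible \<open>t\<close> is closed and upward closed.  It is nonempty and bounded below because
  \<open>y\<close> lies between two multiples of \<open>e\<close>, so the minimum in the definition is attained.
\<close>
lemma gerstewitz_le_iff: "gerstewitz K e y \<le> t \<longleftrightarrow> t *\<^sub>R e - y \<in> K"
proof -
  define S where "S = {t. t *\<^sub>R e - y \<in> K}"
  obtain M where M: "\<And>y. (M * norm y) *\<^sub>R e - y \<in> K"
    using absorbing by blast
  have "closed ((\<lambda>t. t *\<^sub>R e - y) -` K)"
    by (intro closed_vimage closed continuous_intros)
  then have "closed S"
    by (simp add: S_def vimage_def)
  moreover have "S \<noteq> {}"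
    using M[of y] by (auto simp: S_def)
  moreover have "- (M * norm y) \<le> s" if "s \<in> S" for s
  proof -
    have "(s *\<^sub>R e - y) + ((M * norm (- y)) *\<^sub>R e - (- y)) \<in> K"
      using that M[of "- y"] by (intro add_mem) (auto simp: S_def)
    then have "(s + M * norm y) *\<^sub>R e \<in> K"
      by (simp add: algebra_simps)
    then show ?thesis
      using nonneg_if_multiple_of_e_mem by force
  qed
  then have bdd: "bdd_below S"
    by (rule bdd_belowI)
  ultimately have Inf: "Inf S \<in> S"
    by (intro closed_contains_Inf)
  have "t *\<^sub>R e \<in> {y + k |k. k \<in> K} \<longleftrightarrow> t \<in> S" for t
    by (force simp: S_def algebra_simps intro: exI[of _ "t *\<^sub>R e - y"])
  then have "gerstewitz K e y = (LEAST t. t \<in> S)"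
    by (simp add: gerstewitz_def)
  also have "\<dots> = Inf S"
    using Inf bdd by (intro Least_equality) (auto intro: cInf_lower)
  finally have g: "gerstewitz K e y = Inf S" .
  show ?thesis
  proof
    assume "gerstewitz K e y \<le> t"
    then have "(Inf S *\<^sub>R e - y) + (t - Inf S) *\<^sub>R e \<in> K"
      using Inf g by (intro add_mem scale_mem e_mem) (auto simp: S_def)
    then show "t *\<^sub>R e - y \<in> K"
      by (simp add: algebra_simps)
  next
    assume "t *\<^sub>R e - y \<in> K"
    then show "gerstewitz K e y \<le> t"
      using bdd g by (auto simp: S_def intro: cInf_lower)
  qed
qed

lemma gerstewitz_ge:
  assumes "y - t *\<^sub>R e \<in> K"
  shows "t \<le> gerstewitz K e y"
proof -
  have "(gerstewitz K e y *\<^sub>R e - y) + (y - t *\<^sub>R e) \<in> K"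
    using assms gerstewitz_le_iff by (blast intro: add_mem)
  then have "(gerstewitz K e y - t) *\<^sub>R e \<in> K"
    by (simp add: algebra_simps)
  then show ?thesis
    using nonneg_if_multiple_of_e_mem by force
qed

lemma gerstewitz_zero: "gerstewitz K e 0 = 0"
  using gerstewitz_le_iff[of 0 0] gerstewitz_ge[of 0 0] zero_mem by simp

lemma gerstewitz_neg_iff: "gerstewitz K e y < 0 \<longleftrightarrow> - y \<in> interior K"
proof
  assume neg: "gerstewitz K e y < 0"
  have "(gerstewitz K e y *\<^sub>R e - y) + (- gerstewitz K e y) *\<^sub>R e \<in> interior K"
    using neg gerstewitz_le_iff
    by (intro interior_add interior_scale e_interior) auto
  then show "- y \<in> interior K"
    by simp
next
  assume "- y \<in> interior K"
  then obtain \<rho> where \<rho>: "\<rho> > 0" "cball (- y) \<rho> \<subseteq> K"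
    using mem_interior_cball by blast
  have "e \<noteq> 0"
    using minus_e_not_mem zero_mem by auto
  then have "(- (\<rho> / norm e)) *\<^sub>R e - y \<in> cball (- y) \<rho>"
    using \<rho>(1) by (simp add: dist_norm)
  then have "gerstewitz K e y \<le> - (\<rho> / norm e)"
    using \<rho>(2) gerstewitz_le_iff by blast
  also have "\<dots> < 0"
    using \<rho>(1) \<open>e \<noteq> 0\<close> by simp
  finally show "gerstewitz K e y < 0" .
qed

lemma gerstewitz_lipschitz:
  obtains M where "M-lipschitz_on UNIV (gerstewitz K e)"
proof -
  obtain M where M: "M > 0" "\<And>y. (M * norm y) *\<^sub>R e - y \<in> K"
    using absorbing by blast
  have *: "gerstewitz K e y \<le> gerstewitz K e z + M * norm (y - z)" for y z
  proof -
    have "(gerstewitz K e z *\<^sub>R e - z) + ((M * norm (y - z)) *\<^sub>R e - (y - z)) \<in> K"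
      using M(2) gerstewitz_le_iff by (blast intro: add_mem)
    then show ?thesis
      by (simp add: gerstewitz_le_iff algebra_simps)
  qed
  have "M-lipschitz_on UNIV (gerstewitz K e)"
  proof (rule lipschitz_onI)
    fix y z
    show "dist (gerstewitz K e y) (gerstewitz K e z) \<le> M * dist y z"
      using *[of y z] *[of z y] by (simp add: dist_norm norm_minus_commute abs_le_iff)
  qed (use M in simp)
  then show ?thesis
    by (rule that)
qed

lemma continuous_on_gerstewitz:
  assumes "continuous_on S h"
  shows "continuous_on S (\<lambda>x. gerstewitz K e (h x))"
proof -
  have "continuous_on UNIV (gerstewitz K e)"
    using gerstewitz_lipschitz lipschitz_on_continuous_on by blast
  then show ?thesis
    using assms by (rule continuous_on_compose2) auto
qed

text \<open>
  Differing by a nonzero element of \<open>K\<close> is a strict partial order: it is asymmetric because \<open>K\<close> is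
  pointed and transitive because \<open>K\<close> is closed under addition.  A finite nonempty set has a minimal
  element for any such order.
\<close>
lemma Min_set_nonempty:
  assumes "finite A" "A \<noteq> {}"
  shows "Min_set A K \<noteq> {}"
proof -
  define R where "R = (\<lambda>y x. x - y \<in> K \<and> x \<noteq> y)"
  have antisym: "x = y" if "x - y \<in> K" "y - x \<in> K" for x y
    using antisym_mem[of "x - y"] that by simp
  have "asymp_on A R"
    using antisym by (auto simp: R_def asymp_on_def)
  moreover have "transp_on A R"
  proof (rule transp_onI)
    fix x y z
    assume xy: "R x y" and yz: "R y z"
    have "(y - x) + (z - y) \<in> K"
      using xy yz by (intro add_mem) (auto simp: R_def)
    moreover have "x \<noteq> z"
      using xy yz antisym by (auto simp: R_def)
    ultimately show "R x z"
      by (simp add: R_def)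
  qed
  ultimately obtain m where m: "m \<in> A" "\<And>x. x \<in> A \<Longrightarrow> x \<noteq> m \<Longrightarrow> \<not> R x m"
    using Finite_Set.bex_min_element[OF assms(1) _ _ assms(2), of R] by blast
  have "x = m" if "x \<in> A" "x = m - k" "k \<in> K" for x k
    using that m(2)[of x] by (auto simp: R_def)
  moreover have "m \<in> {m - k |k. k \<in> K}"
    using zero_mem by force
  ultimately have "m \<in> Min_set A K"
    using m(1) by (auto simp: Min_set_def)
  then show ?thesis
    by blast
qed

section \<open>Quadratic models with a positive definite form\<close>

text \<open>
  After division by \<open>t\<close> the model along the ray tends to \<open>L\<^sub>j u\<close> as \<open>t\<close> tends to \<open>0\<close>, and \<open>- int K\<close>
  is an open set that contains this limit.
\<close>
lemma descent_step:
  fixes L q :: "'i \<Rightarrow> 'b::real_normed_vector \<Rightarrow> 'a"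
  assumes "finite J"
    and lin: "\<And>j. j \<in> J \<Longrightarrow> linear (L j)"
    and quad: "\<And>j c. j \<in> J \<Longrightarrow> q j (c *\<^sub>R u) = c\<^sup>2 *\<^sub>R q j u"
    and desc: "\<And>j. j \<in> J \<Longrightarrow> - L j u \<in> interior K"
  obtains t where "t > 0"
    "\<And>j. j \<in> J \<Longrightarrow> gerstewitz K e (L j (t *\<^sub>R u) + (1/2) *\<^sub>R q j (t *\<^sub>R u)) < 0"
proof -
  have "\<forall>\<^sub>F t in at_right (0::real). - (L j u + (t/2) *\<^sub>R q j u) \<in> interior K"
    if "j \<in> J" for j
  proof (rule topological_tendstoD[OF _ open_interior desc[OF that]])
    have "((\<lambda>t. - (L j u + (t/2) *\<^sub>R q j u)) \<longlongrightarrow> - (L j u + (0/2) *\<^sub>R q j u)) (at_right 0)"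
      by (intro tendsto_intros) auto
    then show "((\<lambda>t. - (L j u + (t/2) *\<^sub>R q j u)) \<longlongrightarrow> - L j u) (at_right 0)"
      by simp
  qed
  then have "\<forall>\<^sub>F t in at_right (0::real). \<forall>j\<in>J. - (L j u + (t/2) *\<^sub>R q j u) \<in> interior K"
    using \<open>finite J\<close> by (simp add: eventually_ball_finite)
  then have "\<forall>\<^sub>F t in at_right (0::real).
      t > 0 \<and> (\<forall>j\<in>J. - (L j u + (t/2) *\<^sub>R q j u) \<in> interior K)"
    using eventually_at_right_less eventually_conj by blast
  then obtain t :: real where t: "t > 0"
    "\<And>j. j \<in> J \<Longrightarrow> - (L j u + (t/2) *\<^sub>R q j u) \<in> interior K"
    using eventually_happens'[OF trivial_limit_at_right_real] by blast
  have "gerstewitz K e (L j (t *\<^sub>R u) + (1/2) *\<^sub>R q j (t *\<^sub>R u)) < 0" if "j \<in> J" for j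
  proof -
    have "t *\<^sub>R (- (L j u + (t/2) *\<^sub>R q j u)) \<in> interior K"
      by (rule interior_scale[OF t(2)[OF that] t(1)])
    also have "t *\<^sub>R (- (L j u + (t/2) *\<^sub>R q j u)) = - (L j (t *\<^sub>R u) + (1/2) *\<^sub>R q j (t *\<^sub>R u))"
      using linear_scale[OF lin[OF that]] quad[OF that]
      by (simp add: algebra_simps power2_eq_square)
    finally show ?thesis
      by (simp only: gerstewitz_neg_iff)
  qed
  with t(1) show ?thesis
    by (rule that)
qed

lemma descent_if_model_nonpos:
  assumes "d \<in> interior K" and "gerstewitz K e (y + (1/2) *\<^sub>R d) \<le> 0"
  shows "- y \<in> interior K"
proof -
  have "- (y + (1/2) *\<^sub>R d) \<in> K"
    using assms(2) by (simp add: gerstewitz_le_iff)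
  then have "- (y + (1/2) *\<^sub>R d) + (1/2) *\<^sub>R d \<in> interior K"
    using assms(1) by (intro interior_add interior_scale) auto
  then show ?thesis
    by simp
qed

text \<open>
  By compactness of the unit sphere and homogeneity, \<open>q u\<close> dominates \<open>\<delta> \<bar>u\<bar>\<^sup>2 e\<close> for some \<open>\<delta> > 0\<close>,
  whereas \<open>L u\<close> dominates a negative multiple of \<open>\<bar>u\<bar> e\<close>; the quadratic term wins far from the origin.
\<close>
lemma model_coercive:
  fixes L q :: "'b::euclidean_space \<Rightarrow> 'a"
  assumes lin: "linear L"
    and quad: "\<And>c u. q (c *\<^sub>R u) = c\<^sup>2 *\<^sub>R q u"
    and cont: "continuous_on UNIV q"
    and pos: "\<And>u. u \<noteq> 0 \<Longrightarrow> q u \<in> interior K"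
  obtains R where "\<And>u. norm u > R \<Longrightarrow> gerstewitz K e (L u + (1/2) *\<^sub>R q u) > 0"
proof -
  let ?S = "sphere (0::'b) 1"
  have "continuous_on ?S (\<lambda>u. gerstewitz K e (- q u))"
    by (intro continuous_on_gerstewitz continuous_intros continuous_on_subset[OF cont]) auto
  then obtain v where v: "v \<in> ?S"
    and max: "\<And>u. u \<in> ?S \<Longrightarrow> gerstewitz K e (- q u) \<le> gerstewitz K e (- q v)"
    using continuous_attains_sup[of ?S "\<lambda>u. gerstewitz K e (- q u)"]
    by (auto simp del: mem_sphere)
  define \<delta> where "\<delta> = - gerstewitz K e (- q v)"
  have "v \<noteq> 0"
    using v by auto
  then have \<delta>: "\<delta> > 0"
    using pos by (simp add: \<delta>_def gerstewitz_neg_iff)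
  have q_ge: "q u - (\<delta> * (norm u)\<^sup>2) *\<^sub>R e \<in> K" if "u \<noteq> 0" for u
  proof -
    let ?w = "(1 / norm u) *\<^sub>R u"
    have "gerstewitz K e (- q ?w) \<le> - \<delta>"
      using max[of ?w] that by (simp add: \<delta>_def)
    then have "(norm u)\<^sup>2 *\<^sub>R (q ?w - \<delta> *\<^sub>R e) \<in> K"
      by (intro scale_mem) (simp_all add: gerstewitz_le_iff algebra_simps)
    moreover have "(norm u)\<^sup>2 *\<^sub>R q ?w = q u"
      using that by (simp add: quad[of "1 / norm u"] power_divide)
    ultimately show ?thesis
      by (simp add: scaleR_diff_right mult.commute)
  qed
  obtain M where M: "M > 0" "\<And>y. (M * norm y) *\<^sub>R e - y \<in> K"
    using absorbing by blast
  obtain N where N: "N > 0" "\<And>u. norm (L u) \<le> N * norm u"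
    using lin linear_bounded_pos by blast
  have L_ge: "(M * N * norm u) *\<^sub>R e + L u \<in> K" for u
  proof -
    have "((M * norm (- L u)) *\<^sub>R e - (- L u)) + (M * (N * norm u - norm (L u))) *\<^sub>R e \<in> K"
      using M N by (intro add_mem M(2) scale_mem e_mem) auto
    then show ?thesis
      by (simp add: algebra_simps)
  qed
  show ?thesis
  proof (rule that)
    fix u :: 'b
    assume u: "norm u > 2 * M * N / \<delta>"
    then have "0 < norm u"
      using M(1) N(1) \<delta> by (smt (verit) divide_pos_pos mult_pos_pos)
    define s where "s = \<delta> / 2 * (norm u)\<^sup>2 - M * N * norm u"
    have "(1/2) *\<^sub>R (q u - (\<delta> * (norm u)\<^sup>2) *\<^sub>R e) + ((M * N * norm u) *\<^sub>R e + L u) \<in> K"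
      using \<open>0 < norm u\<close> by (intro add_mem scale_mem q_ge L_ge) auto
    then have "(L u + (1/2) *\<^sub>R q u) - s *\<^sub>R e \<in> K"
      by (simp add: s_def algebra_simps)
    then have "s \<le> gerstewitz K e (L u + (1/2) *\<^sub>R q u)"
      by (rule gerstewitz_ge)
    moreover have "s = norm u * (\<delta> / 2 * norm u - M * N)"
      by (simp add: s_def power2_eq_square algebra_simps)
    moreover have "\<delta> / 2 * norm u - M * N > 0"
      using u \<delta> by (simp add: field_simps)
    ultimately show "gerstewitz K e (L u + (1/2) *\<^sub>R q u) > 0"
      using \<open>0 < norm u\<close> by (smt (verit) mult_pos_pos)
  qed
qed

end

lemma quad_form_scaleR: "quad_form H (c *\<^sub>R u) = c\<^sup>2 *\<^sub>R quad_form H u"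
  by (simp add: quad_form_def vec_eq_iff matrix_vector_mult_scaleR power2_eq_square)

lemma continuous_on_quad_form: "continuous_on S (quad_form H)"
  unfolding quad_form_def
  by (intro continuous_intros linear_continuous_on matrix_vector_mul_bounded_linear)

section \<open>Existence of minima\<close>

lemma continuous_on_Max_image:
  fixes h :: "'i \<Rightarrow> 'a::topological_space \<Rightarrow> real"
  assumes "finite J" "J \<noteq> {}" "\<And>j. j \<in> J \<Longrightarrow> continuous_on S (h j)"
  shows "continuous_on S (\<lambda>x. Max ((\<lambda>j. h j x) ` J))"
  using assms
proof (induction J rule: finite_ne_induct)
  case (insert j J)
  then have "continuous_on S (\<lambda>x. max (h j x) (Max ((\<lambda>j. h j x) ` J)))"
    by (intro continuous_on_max) auto
  then show ?case
    using insert.hyps by simp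
qed simp

lemma attains_min_if_larger_outside_ball:
  fixes h :: "'a::euclidean_space \<Rightarrow> real"
  assumes "continuous_on UNIV h" and "\<And>u. norm u > R \<Longrightarrow> h 0 \<le> h u"
  obtains v where "\<And>u. h v \<le> h u"
proof -
  let ?B = "cball (0::'a) \<bar>R\<bar>"
  obtain v where v: "v \<in> ?B" "\<And>u. u \<in> ?B \<Longrightarrow> h v \<le> h u"
    using continuous_attains_inf[of ?B h] continuous_on_subset[OF assms(1)]
    by (auto simp del: mem_cball)
  have "h v \<le> h u" for u
    using v(2)[of u] v(2)[of 0] assms(2)[of u] by fastforce
  then show ?thesis
    by (rule that)
qed

lemma Least_image_le_if_attained_fiberwise:
  fixes h :: "'i \<Rightarrow> 'a \<Rightarrow> real"
  assumes "finite P" "P \<noteq> {}" and att: "\<And>a. a \<in> P \<Longrightarrow> \<exists>v. \<forall>u. h a v \<le> h a u"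
    and "a \<in> P"
  shows "(LEAST t. t \<in> (\<lambda>(a, u). h a u) ` (P \<times> UNIV)) \<le> h a u"
proof -
  obtain v where v: "\<And>a u. a \<in> P \<Longrightarrow> h a (v a) \<le> h a u"
    using att by metis
  let ?m = "Min ((\<lambda>a. h a (v a)) ` P)"
  have "?m \<in> (\<lambda>a. h a (v a)) ` P"
    using assms(1,2) by (intro Min_in) auto
  then have mem: "?m \<in> (\<lambda>(a, u). h a u) ` (P \<times> UNIV)"
    by force
  have low: "?m \<le> h a u" if "a \<in> P" for a u
    using v[OF that, of u] assms(1) that
    by (meson Min_le finite_imageI imageI order_trans)
  have "(LEAST t. t \<in> (\<lambda>(a, u). h a u) ` (P \<times> UNIV)) = ?m"
    using mem low by (intro Least_equality) auto
  with low[OF \<open>a \<in> P\<close>] show ?thesis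
    by simp
qed

section \<open>Stationarity and the optimal value\<close>

lemma (in solid_cone) num_min_pos:
  assumes "p \<ge> 1"
  shows "num_min K f p x \<ge> 1"
proof -
  have "finite (set_map f p x)" "set_map f p x \<noteq> {}"
    using assms by (auto simp: set_map_def)
  moreover from this have "finite (Min_set (set_map f p x) K)"
    by (simp add: Min_set_def)
  ultimately show ?thesis
    using Min_set_nonempty by (simp add: num_min_def Suc_le_eq card_gt_0_iff)
qed

lemma xi_zero:
  fixes K :: "(real^'m) set" and f :: "nat \<Rightarrow> real^'n \<Rightarrow> real^'m"
  assumes "solid_cone K e" and "p \<ge> 1"
  shows "xi K e f p B x a 0 = 0"
proof -
  interpret solid_cone K e by fact
  have "quad_form H 0 = 0" for H :: "(real^'n^'n)^'m"
    using quad_form_scaleR[of H 0 0] by simp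
  then have "xi K e f p B x a 0 = Max ((\<lambda>j. 0) ` {1..num_min K f p x})"
    by (simp add: xi_def gerstewitz_zero)
  also have "\<dots> = 0"
    using num_min_pos[OF \<open>p \<ge> 1\<close>, of f x] by (simp add: image_constant_conv)
  finally show ?thesis .
qed

lemma partition_set_index:
  assumes "a \<in> partition_set K f p r x" "j \<in> {1..num_min K f p x}"
  shows "a j \<in> {1..p}"
  using assms by (fastforce simp: partition_set_def active_indices_at_def active_indices_def)

lemma finite_partition_set: "finite (partition_set K f p r x)"
  unfolding partition_set_def
  by (intro finite_PiE) (auto simp: active_indices_at_def active_indices_def)

text \<open>
  The least value is a lower bound only because it is attained: for each of the finitely many
  tuples \<open>\<xi>\<close> is continuous in the direction and exceeds its value at \<open>0\<close> outside a ball.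
\<close>
lemma Phi_le_xi:
  fixes K :: "(real^'m) set" and f :: "nat \<Rightarrow> real^'n \<Rightarrow> real^'m"
  assumes "solid_cone K e" and "p \<ge> 1"
    and pd: "\<And>i. i \<in> {1..p} \<Longrightarrow> K_positive_definite K (B i x)"
    and a: "a \<in> partition_set K f p r x"
  shows "Phi K e f p B r x \<le> xi K e f p B x a u"
  unfolding Phi_def
proof (rule Least_image_le_if_attained_fiberwise[OF finite_partition_set _ _ a])
  interpret solid_cone K e by fact
  let ?J = "{1..num_min K f p x}"
  show "partition_set K f p r x \<noteq> {}"
    using a by blast
  fix b
  assume b: "b \<in> partition_set K f p r x"
  let ?L = "\<lambda>j u. transpose (grad (f (b j)) x) *v u"
  let ?q = "\<lambda>j. quad_form (B (b j) x)"
  let ?h = "\<lambda>j u. gerstewitz K e (?L j u + (1/2) *\<^sub>R ?q j u)"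
  have one: "1 \<in> ?J"
    using num_min_pos[OF \<open>p \<ge> 1\<close>] by simp
  \<comment> \<open>A single component of the maximum already forces growth.\<close>
  have "K_positive_definite K (B (b 1) x)"
    using pd partition_set_index[OF b one] by blast
  then obtain R where R: "\<And>u. norm u > R \<Longrightarrow> ?h 1 u > 0"
    using model_coercive[of "?L 1" "?q 1"] quad_form_scaleR continuous_on_quad_form
    unfolding K_positive_definite_def by (metis matrix_vector_mul_linear)
  have "continuous_on UNIV (xi K e f p B x b)"
    unfolding xi_def
    by (intro continuous_on_Max_image continuous_on_gerstewitz continuous_intros
        continuous_on_quad_form linear_continuous_on matrix_vector_mul_bounded_linear)
      (use one in auto)
  moreover have "xi K e f p B x b 0 \<le> xi K e f p B x b u" if "norm u > R" for u
  proof -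
    have "xi K e f p B x b 0 = 0"
      by (rule xi_zero[OF solid_cone_axioms \<open>p \<ge> 1\<close>])
    also have "0 \<le> ?h 1 u"
      using R[OF that] by simp
    also have "\<dots> \<le> xi K e f p B x b u"
      unfolding xi_def using one by (intro Max_ge) auto
    finally show ?thesis .
  qed
  ultimately show "\<exists>v. \<forall>u. xi K e f p B x b v \<le> xi K e f p B x b u"
    using attains_min_if_larger_outside_ball by metis
qed

theorem theorem4p3:
  fixes K :: "(real^'m) set" and e :: "real^'m"
    and f :: "nat \<Rightarrow> real^'n \<Rightarrow> real^'m" and p :: nat
    and B :: "nat \<Rightarrow> real^'n \<Rightarrow> (real^'n^'n)^'m"
    and r :: "real^'n \<Rightarrow> nat \<Rightarrow> real^'m"
    and xbar ubar :: "real^'n" and abar :: "nat \<Rightarrow> nat"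
  assumes "closed K" and "convex K" and "cone K" and "pointed K" and "interior K \<noteq> {}"
    and "e \<in> interior K"
    and "p \<ge> 1"
    and "\<And>i. i \<in> {1..p} \<Longrightarrow> twice_continuously_differentiable (f i)"
    and "\<And>i x. i \<in> {1..p} \<Longrightarrow> symmetric_tuple (B i x)"
    and "\<And>i x. i \<in> {1..p} \<Longrightarrow> K_positive_definite K (B i x)"
    and "enumerates_min K f p r"
    and "abar \<in> partition_set K f p r xbar"
    and "Phi K e f p B r xbar = xi K e f p B xbar abar ubar"
  shows "(\<not> stationary_point K f p r xbar \<longleftrightarrow> Phi K e f p B r xbar < 0)
       \<and> (Phi K e f p B r xbar < 0 \<longleftrightarrow> ubar \<noteq> 0)"
proof -
  interpret solid_cone K e
    using assms by unfold_locales
  let ?J = "{1..num_min K f p xbar}" and ?P = "partition_set K f p r xbar"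
  let ?Phi = "Phi K e f p B r xbar"
  let ?L = "\<lambda>a j u. transpose (grad (f (a j)) xbar) *v u"
  let ?q = "\<lambda>a j. quad_form (B (a j) xbar)"
  let ?h = "\<lambda>a j u. gerstewitz K e (?L a j u + (1/2) *\<^sub>R ?q a j u)"
  have J: "?J \<noteq> {}"
    using num_min_pos[OF \<open>p \<ge> 1\<close>, of f xbar] by simp
  have Phi_le: "?Phi \<le> xi K e f p B xbar a u" if "a \<in> ?P" for a u
    using Phi_le_xi[OF solid_cone_axioms \<open>p \<ge> 1\<close> assms(10) that] .
  have nonstationary_iff:
    "\<not> stationary_point K f p r xbar \<longleftrightarrow> (\<exists>a\<in>?P. \<exists>u. \<forall>j\<in>?J. - ?L a j u \<in> interior K)"
  proof -
    have "y \<in> uminus ` interior K \<longleftrightarrow> - y \<in> interior K" for y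
      by (metis image_iff minus_minus)
    then show ?thesis
      by (simp add: stationary_point_def)
  qed
  have descent: "?Phi < 0" if nonstat: "\<not> stationary_point K f p r xbar"
  proof -
    obtain a u where a: "a \<in> ?P" and desc: "\<And>j. j \<in> ?J \<Longrightarrow> - ?L a j u \<in> interior K"
      using nonstat nonstationary_iff by blast
    obtain t where "\<And>j. j \<in> ?J \<Longrightarrow> ?h a j (t *\<^sub>R u) < 0"
      using descent_step[of ?J "?L a" "?q a" u] desc quad_form_scaleR matrix_vector_mul_linear
      by (metis finite_atLeastAtMost)
    then have "xi K e f p B xbar a (t *\<^sub>R u) < 0"
      unfolding xi_def using J by (subst Max_less_iff) auto
    then show ?thesis
      using Phi_le[OF a, of "t *\<^sub>R u"] by linarith
  qed
  have nonzero: "ubar \<noteq> 0" if "?Phi < 0"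
    using that assms(13) by (auto simp: xi_zero[OF solid_cone_axioms \<open>p \<ge> 1\<close>])
  have nonstationary: "\<not> stationary_point K f p r xbar" if "ubar \<noteq> 0"
  proof -
    have nonpos: "xi K e f p B xbar abar ubar \<le> 0"
      using Phi_le[OF assms(12), of 0] assms(13)
      by (simp add: xi_zero[OF solid_cone_axioms \<open>p \<ge> 1\<close>])
    have "- ?L abar j ubar \<in> interior K" if j: "j \<in> ?J" for j
    proof (rule descent_if_model_nonpos)
      show "?q abar j ubar \<in> interior K"
        using assms(10) partition_set_index[OF assms(12) j] \<open>ubar \<noteq> 0\<close>
        by (simp add: K_positive_definite_def)
      have "?h abar j ubar \<le> xi K e f p B xbar abar ubar"
        unfolding xi_def using j by (intro Max_ge) auto
      then show "?h abar j ubar \<le> 0"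
        using nonpos by linarith
    qed
    then show ?thesis
      using nonstationary_iff assms(12) by blast
  qed
  show ?thesis
    using descent nonzero nonstationary by blast
qed

end
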